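(* Let $f^*=\min\{f(x)\mid x\in\Delta\}$ (with $f^*=+\infty$ if $\Delta=\emptyset$). Let $\rho\in\mathbb{R}$ (threshold parameter) and $\sigma>0$ (penalty parameter), put $h(x)=f(x)+\sigma\lVert Ax-b\rVert^2$ and $h^*=\min\{h(x)\mid x\in\{-1,1\}^n\}$. Assume that: (1) there is no $x\in\Delta$ with $f(x)>\rho$; (2) for every $x\in\Delta^c$ one has $h(x)>\rho$. Then, if $f^*<+\infty$, we have $h^*=f^*$. Moreover, $\Delta=\emptyset$ if and only if $h^*>\rho$.
   Context: Let $\hat F\in\mathbb{R}^{n\times n}$ be symmetric, $\hat c\in\mathbb{R}^n$, $\hat A\in\mathbb{Z}^{m\times n}$, $\hat b\in\mathbb{Z}^m$ (data of the problem $\min\{y^\top\hat Fy+\hat c^\top y\mid \hat Ay=\hat b,\ y\in\{0,1\}^n\}$). With $e$ the all-ones vector, the substitution $x=2y-e$ gives the data $F=\frac14\hat F$, $c=\frac12(\hat c+\hat Fe)$, $\alpha=\frac12\hat c^\top e+\frac14e^\top\hat Fe$, $A=\frac12\hat A$, $b=\hat b-\frac12\hat Ae$. Set $f(x)=x^\top Fx+c^\top x+\alpha$, $\Delta=\{x\in\{-1,1\}^n\mid Ax=b\}$ (feasible points) and $\Delta^c=\{x\in\{-1,1\}^n\mid Ax\neq b\}$. $\lVert\cdot\rVert$ is the Euclidean norm. *)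

theory Defs
  imports "HOL-Analysis.Analysis" "HOL-Library.Extended_Real"
begin

text \<open>
  Data of the problem on \<open>{-1,1}\<close>-vectors obtained from the binary problem
  \<open>min y\<^sup>T Fh y + ch\<^sup>T y\<close> subject to \<open>Ah y = bh\<close>, \<open>y \<in> {0,1}\<^sup>n\<close> by the substitution
  \<open>x = 2 y - e\<close>. The all-ones vector \<open>e\<close> is \<open>vec 1\<close>.
\<close>

definition of_int_vec :: "int ^ 'm \<Rightarrow> real ^ 'm" where
  "of_int_vec v = (\<chi> i. of_int (v $ i))"

definition of_int_mat :: "int ^ 'n ^ 'm \<Rightarrow> real ^ 'n ^ 'm" where
  "of_int_mat M = (\<chi> i j. of_int (M $ i $ j))"

definition pm_F :: "real ^ 'n ^ 'n \<Rightarrow> real ^ 'n ^ 'n" where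
  "pm_F Fh = (1 / 4) *\<^sub>R Fh"

definition pm_c :: "real ^ 'n ^ 'n \<Rightarrow> real ^ 'n \<Rightarrow> real ^ 'n" where
  "pm_c Fh ch = (1 / 2) *\<^sub>R (ch + Fh *v vec 1)"

definition pm_alpha :: "real ^ 'n ^ 'n \<Rightarrow> real ^ 'n \<Rightarrow> real" where
  "pm_alpha Fh ch = (1 / 2) * (ch \<bullet> vec 1) + (1 / 4) * (vec 1 \<bullet> (Fh *v vec 1))"

definition pm_A :: "int ^ 'n ^ 'm \<Rightarrow> real ^ 'n ^ 'm" where
  "pm_A Ah = (1 / 2) *\<^sub>R of_int_mat Ah"

definition pm_b :: "int ^ 'n ^ 'm \<Rightarrow> int ^ 'm \<Rightarrow> real ^ 'm" where
  "pm_b Ah bh = of_int_vec bh - (1 / 2) *\<^sub>R (of_int_mat Ah *v vec 1)"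

definition pm_cube :: "(real ^ 'n) set" where
  "pm_cube = {x. \<forall>i. x $ i \<in> {-1, 1}}"

definition feasible :: "int ^ 'n ^ 'm \<Rightarrow> int ^ 'm \<Rightarrow> (real ^ 'n) set" where
  "feasible Ah bh = {x \<in> pm_cube. pm_A Ah *v x = pm_b Ah bh}"

definition infeasible :: "int ^ 'n ^ 'm \<Rightarrow> int ^ 'm \<Rightarrow> (real ^ 'n) set" where
  "infeasible Ah bh = {x \<in> pm_cube. pm_A Ah *v x \<noteq> pm_b Ah bh}"

definition objective :: "real ^ 'n ^ 'n \<Rightarrow> real ^ 'n \<Rightarrow> real ^ 'n \<Rightarrow> real" where
  "objective Fh ch x = x \<bullet> (pm_F Fh *v x) + pm_c Fh ch \<bullet> x + pm_alpha Fh ch"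

definition penalized ::
  "real ^ 'n ^ 'n \<Rightarrow> real ^ 'n \<Rightarrow> int ^ 'n ^ 'm \<Rightarrow> int ^ 'm \<Rightarrow> real \<Rightarrow> real ^ 'n \<Rightarrow> real" where
  "penalized Fh ch Ah bh \<sigma> x =
     objective Fh ch x + \<sigma> * (norm (pm_A Ah *v x - pm_b Ah bh))\<^sup>2"

text \<open>
  The minima range over subsets of the finite set \<open>pm_cube\<close>, so \<open>Min\<close> is a genuine minimum
  whenever the set is nonempty; \<open>pm_cube\<close> itself is always nonempty.
\<close>

definition f_star ::
  "real ^ 'n ^ 'n \<Rightarrow> real ^ 'n \<Rightarrow> int ^ 'n ^ 'm \<Rightarrow> int ^ 'm \<Rightarrow> ereal" where
  "f_star Fh ch Ah bh =
     (if feasible Ah bh = {} then \<infinity> else ereal (Min (objective Fh ch ` feasible Ah bh)))"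

definition h_star ::
  "real ^ 'n ^ 'n \<Rightarrow> real ^ 'n \<Rightarrow> int ^ 'n ^ 'm \<Rightarrow> int ^ 'm \<Rightarrow> real \<Rightarrow> real" where
  "h_star Fh ch Ah bh \<sigma> = Min (penalized Fh ch Ah bh \<sigma> ` pm_cube)"

end

theory Submission
  imports Defs
begin

text \<open>The penalty vanishes on feasible points, so there \<open>penalized\<close> and
  \<open>objective\<close> agree (\<open>penalized_feasible\<close>). The threshold \<rho> separates
  the two parts of the cube given by \<open>pm_cube_split\<close>: feasible values are at most
  \<rho>, infeasible ones exceed it. Hence, if feasible points exist, a best one minimizes
  \<open>penalized\<close> over the whole cube, with value at most \<rho>; if none exist, every
  value, and so the minimum, exceeds \<rho>.\<close>

lemma finite_pm_cube: "finite (pm_cube :: (real ^ 'n) set)"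
proof (rule finite_subset)
  \<comment> \<open>Vectors are functions on a finite index type; over \<open>UNIV\<close> the
    extensionality condition of \<open>PiE\<close> is vacuous.\<close>
  show "pm_cube \<subseteq> vec_lambda ` (\<Pi>\<^sub>E i\<in>(UNIV :: 'n set). {-1, 1 :: real})"
  proof
    fix x :: "real ^ 'n"
    assume "x \<in> pm_cube"
    then have "vec_nth x \<in> (\<Pi>\<^sub>E i\<in>(UNIV :: 'n set). {-1, 1 :: real})"
      by (auto simp: pm_cube_def)
    then show "x \<in> vec_lambda ` (\<Pi>\<^sub>E i\<in>(UNIV :: 'n set). {-1, 1 :: real})"
      by (metis imageI vec_nth_inverse)
  qed
  show "finite (vec_lambda ` (\<Pi>\<^sub>E i\<in>(UNIV :: 'n set). {-1, 1 :: real}))"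
    by (intro finite_imageI finite_PiE) auto
qed

lemma pm_cube_nonempty: "pm_cube \<noteq> {}"
proof -
  have "vec 1 \<in> pm_cube"
    by (simp add: pm_cube_def)
  then show ?thesis
    by blast
qed

lemma pm_cube_split: "pm_cube = feasible Ah bh \<union> infeasible Ah bh"
  by (auto simp: feasible_def infeasible_def)

lemma penalized_feasible:
  "x \<in> feasible Ah bh \<Longrightarrow> penalized Fh ch Ah bh \<sigma> x = objective Fh ch x"
  by (simp add: feasible_def penalized_def)

theorem theorem2:
  fixes Fh :: "real ^ 'n ^ 'n" and ch :: "real ^ 'n"
    and Ah :: "int ^ 'n ^ 'm" and bh :: "int ^ 'm"
    and \<rho> \<sigma> :: real
  assumes "transpose Fh = Fh"
    and "\<sigma> > 0"
    and "\<not> (\<exists>x \<in> feasible Ah bh. objective Fh ch x > \<rho>)"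
    and "\<forall>x \<in> infeasible Ah bh. penalized Fh ch Ah bh \<sigma> x > \<rho>"
  shows "(f_star Fh ch Ah bh < \<infinity> \<longrightarrow> ereal (h_star Fh ch Ah bh \<sigma>) = f_star Fh ch Ah bh)
    \<and> (feasible Ah bh = {} \<longleftrightarrow> h_star Fh ch Ah bh \<sigma> > \<rho>)"
proof (cases "feasible Ah bh = {}")
  case True
  then have "pm_cube = infeasible Ah bh"
    using pm_cube_split by blast
  \<comment> \<open>The strict bound passes to the minimum because it is attained on a finite
    nonempty set.\<close>
  then have "h_star Fh ch Ah bh \<sigma> > \<rho>"
    using assms(4) finite_pm_cube pm_cube_nonempty by (metis (no_types, lifting) h_star_def
      Min_gr_iff finite_imageI image_is_empty imageE)
  with True show ?thesis
    by (simp add: f_star_def)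
next
  case False
  let ?f = "objective Fh ch" and ?h = "penalized Fh ch Ah bh \<sigma>"
  have fin: "finite (feasible Ah bh)"
    using finite_pm_cube pm_cube_split by (metis finite_Un)
  then obtain z where z: "z \<in> feasible Ah bh" "Min (?f ` feasible Ah bh) = ?f z"
    using False by (metis (no_types, lifting) Min_in finite_imageI image_is_empty imageE)
  have z_min: "?f z \<le> ?f x" if "x \<in> feasible Ah bh" for x
    using that fin z(2) by (metis Min_le finite_imageI imageI)
  have z_le: "?f z \<le> \<rho>"
    using z(1) assms(3) by force
  have "Min (?h ` pm_cube) = ?f z"
  proof (rule Min_eqI)
    show "finite (?h ` pm_cube)"
      by (intro finite_imageI finite_pm_cube)
    \<comment> \<open>A feasible preimage of \<open>y\<close> is handled by minimality of
      \<open>z\<close>; an infeasible one has value above \<rho>, hence above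
      \<open>?f z\<close>.\<close>
    show "?f z \<le> y" if "y \<in> ?h ` pm_cube" for y
      using that z_min z_le assms(4) penalized_feasible
      by (fastforce simp: pm_cube_split[of Ah bh])
    show "?f z \<in> ?h ` pm_cube"
      using z(1) penalized_feasible[OF z(1)] pm_cube_split by (metis UnI1 imageI)
  qed
  \<comment> \<open>Both sides of the equivalence are false here: the minimum is
    \<open>?f z\<close>, which \<open>z_le\<close> bounds by \<rho>.\<close>
  with False z z_le show ?thesis
    by (simp add: f_star_def h_star_def)
qed

end
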